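(* For all $d \geq 3$, there exist $d$-polytopes $P$ and $Q$ such that $\mathscr{F}_0^{d-3}(P) \cong \mathscr{F}_0^{d-3}(Q)$ and $\mathscr{F}_2^{d-1}(P) \cong \mathscr{F}_2^{d-1}(Q)$ as posets, but $\mathscr{F}(P) \not\cong \mathscr{F}(Q)$ as posets.
   Context: A $d$-polytope is the convex hull of a finite point set in $\mathbb{R}^d$ whose affine hull is $\mathbb{R}^d$. A face of a $d$-polytope $P$ is either $P$ itself or a set $P \cap H$, where $H \subset \mathbb{R}^d$ is a hyperplane (codimension one affine subspace) that does not intersect the interior of $P$ (so the empty set is a face). For $0 \le k < d$, a $k$-face is a face whose affine hull has dimension $k$. The face poset $\mathscr{F}(P)$ is the set of all faces of $P$, partially ordered by containment, and $\mathscr{F}^k(P)$ denotes the set of $k$-faces. For $0 \le a \le b < d$, the $(a,b)$-skeleton is $\mathscr{F}_a^b(P) := \bigcup_{k=a}^b \mathscr{F}^k(P)$ with the partial order induced from $\mathscr{F}(P)$. The symbol $\cong$ denotes isomorphism of posets. *)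

theory Defs
  imports "HOL-Analysis.Analysis"
begin

text \<open>A \<open>d\<close>-polytope is a full-dimensional polytope in the ambient space; \<open>d\<close> is the dimension of
  that space.\<close>

definition full_polytope :: "'a::euclidean_space set \<Rightarrow> bool" where
  "full_polytope P \<longleftrightarrow> polytope P \<and> affine hull P = UNIV"

definition hyperplane :: "'a::euclidean_space set \<Rightarrow> bool" where
  "hyperplane H \<longleftrightarrow> affine H \<and> aff_dim H = int DIM('a) - 1"

definition faces :: "'a::euclidean_space set \<Rightarrow> 'a set set" where
  "faces P = {F. F = P \<or> (\<exists>H. hyperplane H \<and> H \<inter> interior P = {} \<and> F = P \<inter> H)}"

definition k_faces :: "nat \<Rightarrow> 'a::euclidean_space set \<Rightarrow> 'a set set" where
  "k_faces k P = {F \<in> faces P. aff_dim F = int k}"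

text \<open>Intended for \<open>a \<le> b < d\<close>. The empty face has \<open>aff_dim\<close> equal to \<open>-1\<close>, so neither it nor a
  \<open>d\<close>-polytope itself belongs to such a skeleton.\<close>

definition skeleton :: "nat \<Rightarrow> nat \<Rightarrow> 'a::euclidean_space set \<Rightarrow> 'a set set" where
  "skeleton a b P = (\<Union>k\<in>{a..b}. k_faces k P)"

text \<open>Isomorphism of two sets as posets under the orders induced from their types. For families of
  sets, as used here, this order is inclusion.\<close>

definition poset_isomorphic :: "'a::order set \<Rightarrow> 'b::order set \<Rightarrow> bool" where
  "poset_isomorphic A B \<longleftrightarrow>
     (\<exists>f. bij_betw f A B \<and> (\<forall>x\<in>A. \<forall>y\<in>A. x \<le> y \<longleftrightarrow> f x \<le> f y))"

lemma hyperplane_iff: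
  "hyperplane (H :: 'a::euclidean_space set) \<longleftrightarrow> (\<exists>a b. a \<noteq> 0 \<and> H = {x. a \<bullet> x = b})"
  unfolding hyperplane_def
  using aff_dim_eq_hyperplane[of H] affine_hull_eq[of H] affine_hyperplane by fastforce

text \<open>For full-dimensional polytopes these faces are exactly the library's faces.\<close>

lemma faces_eq_face_of:
  fixes P :: "'a::euclidean_space set"
  assumes "full_polytope P"
  shows "faces P = {F. F face_of P}"
proof -
  have poly: "polytope P" and aff: "affine hull P = UNIV"
    using assms by (auto simp: full_polytope_def)
  have conv: "convex P" and cl: "closed P" and bdd: "bounded P"
    using poly by (auto simp: polytope_imp_convex polytope_imp_closed polytope_imp_bounded)
  have "P \<noteq> {}" using aff by auto
  then have int: "interior P \<noteq> {}"
    using rel_interior_interior[OF aff] rel_interior_eq_empty[OF conv] by simp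
  have clint: "closure (interior P) = P"
    using convex_closure_interior[OF conv int] cl by simp
  show ?thesis
  proof (rule subset_antisym; rule subsetI; unfold mem_Collect_eq)
    fix F assume "F \<in> faces P"
    then consider "F = P" | a b where "a \<noteq> 0" "{x. a \<bullet> x = b} \<inter> interior P = {}"
        "F = P \<inter> {x. a \<bullet> x = b}"
      unfolding faces_def hyperplane_iff by auto
    then show "F face_of P"
    proof cases
      case 1
      then show ?thesis using conv by (simp add: face_of_refl)
    next
      case 2
      have "connected (interior P)"
        by (simp add: conv convex_connected)
      have "interior P \<subseteq> {x. a \<bullet> x \<le> b} \<or> interior P \<subseteq> {x. a \<bullet> x \<ge> b}"
      proof (rule ccontr)
        assume "\<not> ?thesis"
        then obtain x y where "x \<in> interior P" "y \<in> interior P" "\<not> b \<le> a \<bullet> x" "\<not> a \<bullet> y \<le> b"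
          by blast
        then have "x \<in> interior P" "y \<in> interior P" "a \<bullet> x \<le> b" "b \<le> a \<bullet> y"
          by auto
        from connected_ivt_hyperplane[OF \<open>connected (interior P)\<close> this] show False
          using 2(2) by blast
      qed
      then have "P \<subseteq> {x. a \<bullet> x \<le> b} \<or> P \<subseteq> {x. a \<bullet> x \<ge> b}"
        using closure_minimal[OF _ closed_halfspace_le[of a b], of "interior P"]
          closure_minimal[OF _ closed_halfspace_ge[of b a], of "interior P"] clint by auto
      then show ?thesis
        using face_of_Int_supporting_hyperplane_le[OF conv, of a b]
          face_of_Int_supporting_hyperplane_ge[OF conv, of b a] 2(3) by auto
    qed
  next
    fix F assume F: "F face_of P"
    then have "F exposed_face_of P"
      using exposed_face_of_polyhedron[OF polytope_imp_polyhedron[OF poly]] by simp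
    then consider "F = {}" | "F = P" | a b where "a \<noteq> 0" "P \<subseteq> {x. a \<bullet> x \<le> b}"
        "F = P \<inter> {x. a \<bullet> x = b}"
      unfolding exposed_face_of by auto
    then show "F \<in> faces P"
    proof cases
      case 1
      obtain B where B: "\<And>x. x \<in> P \<Longrightarrow> norm x \<le> B" using bdd unfolding bounded_iff by blast
      obtain e :: 'a where e: "norm e = 1" using vector_choose_size[of 1] by auto
      have *: "P \<inter> {x. e \<bullet> x = B + 1} = {}"
      proof -
        have "e \<bullet> x \<noteq> B + 1" if "x \<in> P" for x
          using B[OF that] e norm_cauchy_schwarz[of e x] by simp
        then show ?thesis by auto
      qed
      have "e \<noteq> 0" using e by auto
      then have "hyperplane {x. e \<bullet> x = B + 1}" unfolding hyperplane_iff by blast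
      moreover have "{x. e \<bullet> x = B + 1} \<inter> interior P = {}" using * interior_subset by blast
      ultimately show ?thesis using * 1 unfolding faces_def by blast
    next
      case 2 then show ?thesis by (simp add: faces_def)
    next
      case 3
      have "interior P \<subseteq> {x. a \<bullet> x < b}"
        using interior_mono[OF 3(2)] 3(1) by simp
      then have "{x. a \<bullet> x = b} \<inter> interior P = {}" by auto
      moreover have "hyperplane {x. a \<bullet> x = b}" using 3(1) unfolding hyperplane_iff by blast
      ultimately show ?thesis using 3(3) unfolding faces_def by blast
    qed
  qed
qed

end

theory Submission
  imports Defs
begin

text \<open>
  Start from the simplex with vertices \<open>0\<close> and \<open>e\<^sub>j\<close>, stack a new vertex onto the facet opposite to
  the origin, and cut off the origin. Both operations are carried out degenerately, in mutually
  dual ways: the new vertex (the peak) is put on the hyperplane \<open>x\<^sub>m = 0\<close> of a neighbouring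
  facet, so that this facet grows instead of staying a cell on its own, and the cutting hyperplane
  is put through a neighbour \<open>e\<^sub>k\<close> of the origin, so that one edge disappears completely.
  This gives a polytope for every pair of indices \<open>m\<close>, \<open>k\<close>.

  Compare it with the polytope obtained when both choices are generic. Putting the peak on
  \<open>x\<^sub>m = 0\<close> merges the two facets on either side of the ridge with the vertices \<open>e\<^sub>j\<close>, \<open>j \<noteq> m\<close>; only
  faces of dimensions \<open>d - 2\<close> and \<open>d - 1\<close> notice, so the skeleton of dimensions \<open>0\<close> to \<open>d - 3\<close> does
  not depend on \<open>m\<close>. Dually, letting the cut pass through \<open>e\<^sub>k\<close> contracts an edge to a vertex; only
  faces of dimensions \<open>0\<close> and \<open>1\<close> notice, so the skeleton of dimensions \<open>2\<close> to \<open>d - 1\<close> does not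
  depend on \<open>k\<close>. Up to renaming coordinates only the alternative \<open>m = k\<close> or \<open>m \<noteq> k\<close> matters, and
  therefore both skeleta agree for the two kinds of polytopes. The whole face lattices differ,
  however: for \<open>m = k\<close> the vertex \<open>e\<^sub>k\<close> is the only one outside the facet in \<open>x\<^sub>m = 0\<close>, so the polytope is
  a pyramid, whereas for \<open>m \<noteq> k\<close> every facet misses at least two vertices. In dimension three these
  are the two polyhedra with six vertices and six faces: the pentagonal pyramid, and one with two
  quadrangles.

  The work lies in the face lattice. A face is recorded by the set of labels of the vertices on it.
  Two families of affine relations between the vertices restrict these sets
  (\<open>face_vertex_sets_closure\<close>) to a short list, \<open>cell\<close>; conversely everything in that list is an
  intersection of facets (\<open>cell_is_face_vertex_set\<close>). The list depends on \<open>m\<close> only in the top two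
  dimensions (\<open>low_cell_independent\<close>), and from dimension two upwards the identification of labels
  caused by \<open>k\<close> has no influence on inclusions (\<open>saturate_subset_iff\<close>).
\<close>

section \<open>Faces as sets of vertices\<close>

text \<open>The labels \<open>Corner j\<close> stand for the vertices \<open>e\<^sub>j\<close> of the simplex, and \<open>Cut j\<close> for the point in
  which the cut meets the edge from the origin to \<open>e\<^sub>j\<close>. That point is \<open>e\<^sub>k\<close> itself for \<open>j = k\<close>, so
  \<open>Corner k\<close> and \<open>Cut k\<close> label the same vertex; keeping both makes the list of faces uniform.\<close>

datatype 'd vertex = Peak | Corner 'd | Cut 'd

lemma UNIV_vertex: "(UNIV :: 'd vertex set) = insert Peak (range Corner \<union> range Cut)"
proof (rule set_eqI)
  show "v \<in> UNIV \<longleftrightarrow> v \<in> insert Peak (range Corner \<union> range Cut)" for v :: "'d vertex"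
    by (cases v) auto
qed

instance vertex :: (finite) finite
  by standard (simp add: UNIV_vertex)

definition position :: "'d::finite \<Rightarrow> 'd \<Rightarrow> 'd vertex \<Rightarrow> real ^ 'd" where
  "position m k v = (case v of
      Peak \<Rightarrow> (\<chi> i. if i = m then 0 else 1)
    | Corner j \<Rightarrow> axis j 1
    | Cut j \<Rightarrow> (if j = k then axis j 1 else axis j (1/2)))"

definition cut_stacked_simplex :: "'d::finite \<Rightarrow> 'd \<Rightarrow> (real ^ 'd) set" where
  "cut_stacked_simplex m k = convex hull (range (position m k))"

lemma inner_position [simp]:
  "a \<bullet> position m k Peak = (\<Sum>j\<in>-{m}. a $ j)"
  "a \<bullet> position m k (Corner j) = a $ j"
  "a \<bullet> position m k (Cut j) = (if j = k then a $ j else a $ j / 2)"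
proof -
  have "a \<bullet> position m k Peak = (\<Sum>j\<in>UNIV. if j \<in> -{m} then a $ j else 0)"
    unfolding position_def inner_vec_def by (auto intro: sum.cong)
  also have "\<dots> = (\<Sum>j\<in>-{m}. a $ j)"
    by (subst sum.If_cases) (auto simp: Compl_eq)
  finally show "a \<bullet> position m k Peak = (\<Sum>j\<in>-{m}. a $ j)" .
qed (auto simp: position_def inner_axis)

lemma position_nth:
  "position m k Peak $ i = (if i = m then 0 else 1)"
  "position m k (Corner j) $ i = (if i = j then 1 else 0)"
  "position m k (Cut j) $ i = (if i = j then if j = k then 1 else 1 / 2 else 0)"
  by (auto simp: position_def axis_def)

text \<open>Every face of a polytope is exposed, so a face may be described by a linear functional and the
  labels at which the functional attains its maximum. The trivial functional accounts for the whole
  polytope and, with a strict bound, for the empty face.\<close>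

definition face_vertex_sets :: "'d::finite \<Rightarrow> 'd \<Rightarrow> 'd vertex set set" where
  "face_vertex_sets m k =
     {S. \<exists>a b. (\<forall>v. a \<bullet> position m k v \<le> b) \<and> S = {v. a \<bullet> position m k v = b}}"

lemma face_vertex_sets_UNIV: "UNIV \<in> face_vertex_sets m k"
  unfolding face_vertex_sets_def by (auto intro!: exI[of _ 0])

lemma face_vertex_sets_empty: "{} \<in> face_vertex_sets m k"
  unfolding face_vertex_sets_def
  by (rule CollectI, rule exI[of _ 0], rule exI[of _ 1]) simp

text \<open>The sum of two supporting functionals is extremal exactly where both of them are.\<close>

lemma face_vertex_sets_Int:
  assumes "S \<in> face_vertex_sets m k" "T \<in> face_vertex_sets m k"
  shows "S \<inter> T \<in> face_vertex_sets m k"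
proof -
  obtain a b where a: "\<And>v. a \<bullet> position m k v \<le> b" "S = {v. a \<bullet> position m k v = b}"
    using assms(1) unfolding face_vertex_sets_def by blast
  obtain c e where c: "\<And>v. c \<bullet> position m k v \<le> e" "T = {v. c \<bullet> position m k v = e}"
    using assms(2) unfolding face_vertex_sets_def by blast
  have "(a + c) \<bullet> position m k v \<le> b + e" for v
    using add_mono[OF a(1)[of v] c(1)[of v]] by (simp add: inner_add_left)
  moreover have "S \<inter> T = {v. (a + c) \<bullet> position m k v = b + e}"
  proof (rule set_eqI)
    show "v \<in> S \<inter> T \<longleftrightarrow> v \<in> {v. (a + c) \<bullet> position m k v = b + e}" for v
      using a(1)[of v] c(1)[of v] unfolding a(2) c(2) inner_add_left by auto
  qed
  ultimately show ?thesis unfolding face_vertex_sets_def by blast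
qed

lemma face_vertex_sets_INT:
  assumes "finite I" "\<And>i. i \<in> I \<Longrightarrow> A i \<in> face_vertex_sets m k"
  shows "(\<Inter>i\<in>I. A i) \<in> face_vertex_sets m k"
  using assms by (induction rule: finite_induct)
    (auto intro: face_vertex_sets_UNIV face_vertex_sets_Int)

lemma mem_convex_hull_face_vertex_set:
  assumes "S \<in> face_vertex_sets m k"
  shows "position m k v \<in> convex hull (position m k ` S) \<longleftrightarrow> v \<in> S"
proof
  obtain a b where a: "S = {v. a \<bullet> position m k v = b}"
    using assms unfolding face_vertex_sets_def by blast
  have "convex hull (position m k ` S) \<subseteq> {x. a \<bullet> x = b}"
    by (rule hull_minimal) (auto simp: a convex_hyperplane)
  then show "position m k v \<in> convex hull (position m k ` S) \<Longrightarrow> v \<in> S"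
    by (auto simp: a)
qed (simp add: hull_inc)

lemma convex_hull_face_vertex_sets_subset_iff:
  assumes "S \<in> face_vertex_sets m k" "T \<in> face_vertex_sets m k"
  shows "convex hull (position m k ` S) \<subseteq> convex hull (position m k ` T) \<longleftrightarrow> S \<subseteq> T"
  using mem_convex_hull_face_vertex_set[OF assms(1)] mem_convex_hull_face_vertex_set[OF assms(2)]
  by (meson hull_mono image_mono subset_iff)

text \<open>A supporting hyperplane cuts out a face, and a face of the convex hull of finitely many points
  is the hull of those points lying on it. Hence the face lattice is that of the label sets.\<close>

lemma face_of_cut_stacked_simplex_iff:
  "F face_of cut_stacked_simplex m k \<longleftrightarrow>
     (\<exists>S\<in>face_vertex_sets m k. F = convex hull (position m k ` S))"
proof -
  let ?P = "cut_stacked_simplex m k"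
  have conv: "convex ?P" by (simp add: cut_stacked_simplex_def)
  have poly: "polyhedron ?P"
    unfolding cut_stacked_simplex_def by (simp add: polyhedron_convex_hull)
  have slice: "?P \<inter> {x. a \<bullet> x = b} face_of ?P"
      "?P \<inter> {x. a \<bullet> x = b} = convex hull (position m k ` {v. a \<bullet> position m k v = b})"
    if le: "\<And>v. a \<bullet> position m k v \<le> b" for a b
  proof -
    have "?P \<subseteq> {x. a \<bullet> x \<le> b}"
      unfolding cut_stacked_simplex_def
      by (rule hull_minimal) (auto simp: le convex_halfspace_le)
    then show face: "?P \<inter> {x. a \<bullet> x = b} face_of ?P"
      using face_of_Int_supporting_hyperplane_le[OF conv] by blast
    then obtain V where V: "V \<subseteq> range (position m k)" "?P \<inter> {x. a \<bullet> x = b} = convex hull V"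
      using face_of_convex_hull_subset[of "range (position m k)"] finite_imp_compact
      unfolding cut_stacked_simplex_def by (metis finite finite_imageI)
    have "V \<subseteq> {x. a \<bullet> x = b}" using V(2) hull_subset[of V convex] by blast
    then have "V \<subseteq> position m k ` {v. a \<bullet> position m k v = b}" using V(1) by blast
    then have "?P \<inter> {x. a \<bullet> x = b}
        \<subseteq> convex hull (position m k ` {v. a \<bullet> position m k v = b})"
      unfolding V(2) by (rule hull_mono)
    moreover have "convex hull (position m k ` {v. a \<bullet> position m k v = b})
        \<subseteq> ?P \<inter> {x. a \<bullet> x = b}"
      by (rule hull_minimal)
        (auto simp: cut_stacked_simplex_def hull_inc convex_Int convex_hyperplane)
    ultimately show
      "?P \<inter> {x. a \<bullet> x = b} = convex hull (position m k ` {v. a \<bullet> position m k v = b})"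
      by blast
  qed
  show ?thesis
  proof
    assume "F face_of ?P"
    then have "F exposed_face_of ?P" using exposed_face_of_polyhedron[OF poly] by simp
    then obtain a b where ab: "?P \<subseteq> {x. a \<bullet> x \<le> b}" "F = ?P \<inter> {x. a \<bullet> x = b}"
      unfolding exposed_face_of_def by blast
    have le: "a \<bullet> position m k v \<le> b" for v
    proof -
      have "position m k v \<in> ?P" by (simp add: cut_stacked_simplex_def hull_inc)
      then show ?thesis using ab(1) by blast
    qed
    show "\<exists>S\<in>face_vertex_sets m k. F = convex hull (position m k ` S)"
      unfolding ab(2) slice(2)[OF le] face_vertex_sets_def using le by blast
  next
    assume "\<exists>S\<in>face_vertex_sets m k. F = convex hull (position m k ` S)"
    then show "F face_of ?P"
      unfolding face_vertex_sets_def using slice by fastforce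
  qed
qed

section \<open>The list of faces\<close>

lemma card_Compl_singleton: "card (-{m :: 'd::finite}) = CARD('d) - 1"
  by (simp add: Compl_eq_Diff_UNIV card_Diff_singleton)

lemma third_index:
  fixes m k :: "'d::finite"
  assumes "CARD('d) \<ge> 3"
  obtains i where "i \<noteq> m" "i \<noteq> k"
proof -
  have "card {m, k} < CARD('d)" using assms by (auto simp: card_insert_if)
  then have "{m, k} \<noteq> UNIV" by auto
  then show ?thesis using that by blast
qed

text \<open>If a point is written in two ways as a combination of vertices with positive coefficients,
  then a face containing all vertices of one combination contains those of the other. The second
  claim comes from \<open>e\<^sub>i / 2 + (1/2) e\<^sub>j = e\<^sub>j / 2 + (1/2) e\<^sub>i\<close>. In the third, the segment from the peak
  to the origin meets the simplex spanned by the \<open>e\<^sub>j\<close> with \<open>j \<noteq> m\<close>, and the missing origin is expressed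
  as \<open>2 (e\<^sub>i / 2) - e\<^sub>i\<close>; with \<open>p\<close> for the peak this gives
  \<open>p + 2 (d - 2) (e\<^sub>i / 2) = (\<Sum>j\<noteq>m. e\<^sub>j) + (d - 2) e\<^sub>i\<close>, with coefficient sum \<open>2 d - 3\<close> on both
  sides.\<close>

lemma face_vertex_sets_closure:
  fixes m k :: "'d::finite"
  assumes "CARD('d) \<ge> 3" "S \<in> face_vertex_sets m k"
  shows "Cut k \<in> S \<longleftrightarrow> Corner k \<in> S"
    and "i \<noteq> k \<Longrightarrow> j \<noteq> k \<Longrightarrow> Cut i \<in> S \<Longrightarrow> Corner j \<in> S \<Longrightarrow> Corner i \<in> S \<and> Cut j \<in> S"
    and "i \<noteq> k \<Longrightarrow> Peak \<in> S \<and> Cut i \<in> S \<longleftrightarrow> Corner i \<in> S \<and> (\<forall>j\<in>-{m}. Corner j \<in> S)"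
proof -
  obtain a b where le: "\<And>v. a \<bullet> position m k v \<le> b"
    and S: "S = {v. a \<bullet> position m k v = b}"
    using assms(2) unfolding face_vertex_sets_def by blast
  \<comment> \<open>Slacks are affine and nonnegative, so they turn each affine relation between vertices into an
    equation between sums of nonnegative numbers.\<close>
  define slack where "slack v = b - a \<bullet> position m k v" for v
  have nonneg: "slack v \<ge> 0" for v using le by (simp add: slack_def)
  have mem: "v \<in> S \<longleftrightarrow> slack v = 0" for v by (auto simp: S slack_def)
  show "Cut k \<in> S \<longleftrightarrow> Corner k \<in> S" by (simp add: S)
  show "Corner i \<in> S \<and> Cut j \<in> S" if "i \<noteq> k" "j \<noteq> k" "Cut i \<in> S" "Corner j \<in> S"
  proof -
    have "slack (Cut i) + slack (Corner j) / 2 = slack (Cut j) + slack (Corner i) / 2"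
      using that(1,2) by (simp add: slack_def field_simps)
    then show ?thesis
      using that(3,4) nonneg[of "Cut j"] nonneg[of "Corner i"] unfolding mem by linarith
  qed
  show "Peak \<in> S \<and> Cut i \<in> S \<longleftrightarrow> Corner i \<in> S \<and> (\<forall>j\<in>-{m}. Corner j \<in> S)" if "i \<noteq> k"
  proof -
    define d where "d = real CARD('d)"
    have d: "d \<ge> 3" using assms(1) by (simp add: d_def)
    have card: "real (card (-{m})) = d - 1"
      using assms(1) by (simp add: d_def card_Compl_singleton of_nat_diff)
    have "slack Peak + 2 * (d - 2) * slack (Cut i)
        = (\<Sum>j\<in>-{m}. slack (Corner j)) + (d - 2) * slack (Corner i)"
      using that by (simp add: slack_def sum_subtractf card algebra_simps)
    moreover have "slack Peak + 2 * (d - 2) * slack (Cut i) = 0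
        \<longleftrightarrow> slack Peak = 0 \<and> slack (Cut i) = 0"
      using nonneg[of Peak] nonneg[of "Cut i"] d by (simp add: add_nonneg_eq_0_iff)
    moreover have "(\<Sum>j\<in>-{m}. slack (Corner j)) + (d - 2) * slack (Corner i) = 0
        \<longleftrightarrow> (\<forall>j\<in>-{m}. slack (Corner j) = 0) \<and> slack (Corner i) = 0"
      using nonneg d by (simp add: add_nonneg_eq_0_iff sum_nonneg sum_nonneg_eq_0_iff)
    ultimately show ?thesis unfolding mem by auto
  qed
qed

text \<open>The effect of the degenerate cut: a face contains both labels of the vertex \<open>e\<^sub>k\<close> or none.\<close>

definition saturate :: "'d \<Rightarrow> 'd vertex set \<Rightarrow> 'd vertex set" where
  "saturate k X = X \<union> (if Corner k \<in> X \<or> Cut k \<in> X then {Corner k, Cut k} else {})"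

lemma position_saturate: "position m k ` saturate k X = position m k ` X"
proof -
  have "position m k (Cut k) = position m k (Corner k)" by (simp add: position_def)
  then show ?thesis unfolding saturate_def by (auto intro: rev_image_eqI)
qed

text \<open>The nonempty proper faces with their dimensions, given by possibly unsaturated label sets. The
  simplex on all corners is excluded because the stacking covers it. The peak on \<open>x\<^sub>m = 0\<close> is
  responsible for excluding \<open>-{m}\<close> and for the last clause: the ridge with corners
  \<open>-{m}\<close> is no longer a face, because the wall and the cone on either side of it lie in the same
  hyperplane and form a single large facet. The clause for walls omits \<open>{k}\<close>, where the edge
  from \<open>Corner k\<close> to \<open>Cut k\<close> has been contracted to a vertex.\<close>

inductive cell :: "'d::finite \<Rightarrow> 'd \<Rightarrow> 'd vertex set \<Rightarrow> nat \<Rightarrow> bool" for m k where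
  cut: "card J = Suc n \<Longrightarrow> cell m k (Cut ` J) n"
| corner: "card J = Suc n \<Longrightarrow> J \<noteq> UNIV \<Longrightarrow> J \<noteq> -{m} \<Longrightarrow> cell m k (Corner ` J) n"
| wall: "card J = n \<Longrightarrow> J \<noteq> {} \<Longrightarrow> J \<noteq> {k} \<Longrightarrow> J \<noteq> UNIV \<Longrightarrow> J \<noteq> -{m}
    \<Longrightarrow> cell m k (Corner ` J \<union> Cut ` J) n"
| cone: "card J = n \<Longrightarrow> J \<noteq> UNIV \<Longrightarrow> J \<noteq> -{m} \<Longrightarrow> cell m k (insert Peak (Corner ` J)) n"
| large: "cell m k (insert Peak (Corner ` (-{m}) \<union> Cut ` (-{m}))) (CARD('d) - 1)"

text \<open>If both corners and cut points occur with indices other than \<open>k\<close>, the exchange of indices makes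
  their index sets equal in the absence of the peak; and the peak cannot occur together with a cut
  point other than \<open>e\<^sub>k\<close> unless the whole large facet is present.\<close>

lemma face_vertex_set_is_cell:
  fixes m k :: "'d::finite"
  assumes d: "CARD('d) \<ge> 3" and S: "S \<in> face_vertex_sets m k" "S \<noteq> {}" "S \<noteq> UNIV"
  shows "\<exists>X n. cell m k X n \<and> S = saturate k X"
proof -
  note closure = face_vertex_sets_closure[OF d S(1)]
  obtain t where t: "t \<noteq> m" "t \<noteq> k" using third_index[OF d] by blast
  define I where "I = {j. Cut j \<in> S}"
  define J where "J = {j. Corner j \<in> S}"
  have memI: "Cut j \<in> S \<longleftrightarrow> j \<in> I" and memJ: "Corner j \<in> S \<longleftrightarrow> j \<in> J" for j
    by (auto simp: I_def J_def)
  have k: "k \<in> I \<longleftrightarrow> k \<in> J" using closure(1) by (simp add: memI memJ)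
  have S_eq: "S = (if Peak \<in> S then {Peak} else {}) \<union> Corner ` J \<union> Cut ` I"
  proof (rule set_eqI)
    show "v \<in> S \<longleftrightarrow> v \<in> (if Peak \<in> S then {Peak} else {}) \<union> Corner ` J \<union> Cut ` I" for v
      by (cases v) (auto simp: memI memJ)
  qed
  \<comment> \<open>A proper face cannot contain all corners, since these force the peak and all cut points.\<close>
  have J_UNIV: "J \<noteq> UNIV"
  proof
    assume J: "J = UNIV"
    then have "Peak \<in> S" "i \<in> I" for i
      using closure(3)[of t] closure(3)[of i] t k by (auto simp: memI memJ)
    then have "v \<in> S" for v using J by (cases v) (auto simp: memI memJ)
    then show False using S(3) by blast
  qed
  show ?thesis
  proof (cases "Peak \<in> S")
    case Peak: True
    show ?thesis
    proof (cases "I \<subseteq> {k}")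
      case True
      then have "J \<noteq> -{m}" using closure(3)[of t] t by (auto simp: memI memJ)
      then have "cell m k (insert Peak (Corner ` J)) (card J)" using J_UNIV by (auto intro: cone)
      moreover have "S = saturate k (insert Peak (Corner ` J))"
        using True k Peak by (subst S_eq) (auto simp: saturate_def)
      ultimately show ?thesis by blast
    next
      case False
      then obtain i where i: "i \<in> I" "i \<noteq> k" by blast
      have J: "i \<in> J" "-{m} \<subseteq> J" using closure(3)[OF i(2)] Peak i(1) by (auto simp: memI memJ)
      then have J_eq: "J = -{m}" using J_UNIV
        by (metis Compl_subset_Compl_iff Compl_empty_eq double_compl subset_singleton_iff)
      have "I = J"
      proof (intro set_eqI)
        fix j show "j \<in> I \<longleftrightarrow> j \<in> J"
          using closure(3)[of j] Peak J(2) k by (cases "j = k") (auto simp: memI memJ)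
      qed
      then have "S = saturate k (insert Peak (Corner ` (-{m}) \<union> Cut ` (-{m})))"
        using Peak by (subst S_eq) (auto simp: saturate_def J_eq)
      then show ?thesis using large by blast
    qed
  next
    case Peak: False
    then have J_m: "J \<noteq> -{m}" using closure(3)[of t] t by (auto simp: memI memJ)
    show ?thesis
    proof (cases "I \<subseteq> {k} \<or> J \<subseteq> {k}")
      case True
      then show ?thesis
      proof
        assume I: "I \<subseteq> {k}"
        then have "S = saturate k (Corner ` J)"
          using k Peak by (subst S_eq) (auto simp: saturate_def)
        moreover have "J \<noteq> {}" using S(2) calculation by (auto simp: saturate_def)
        then have "card J = Suc (card J - 1)" by (simp add: card_gt_0_iff)
        then have "cell m k (Corner ` J) (card J - 1)" using J_UNIV J_m by (intro corner)
        ultimately show ?thesis by blast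
      next
        assume J: "J \<subseteq> {k}"
        then have "S = saturate k (Cut ` I)"
          using k Peak by (subst S_eq) (auto simp: saturate_def)
        moreover have "I \<noteq> {}" using S(2) calculation by (auto simp: saturate_def)
        then have "card I = Suc (card I - 1)" by (simp add: card_gt_0_iff)
        then have "cell m k (Cut ` I) (card I - 1)" by (intro cut)
        ultimately show ?thesis by blast
      qed
    next
      case False
      then obtain i j where ij: "i \<in> I" "i \<noteq> k" "j \<in> J" "j \<noteq> k" by blast
      have "I = J"
      proof (rule set_eqI)
        show "x \<in> I \<longleftrightarrow> x \<in> J" for x
          using closure(2)[of x j] closure(2)[of i x] ij k
          by (cases "x = k") (auto simp: memI memJ)
      qed
      then have "S = saturate k (Corner ` J \<union> Cut ` J)"
        using Peak by (subst S_eq) (auto simp: saturate_def)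
      moreover have "cell m k (Corner ` J \<union> Cut ` J) (card J)"
        using J_UNIV J_m ij by (intro wall) auto
      ultimately show ?thesis by blast
    qed
  qed
qed


text \<open>The facets, as label sets: the cut itself, the facets in the coordinate hyperplanes, and those
  spanned by the peak and all corners but one.\<close>

definition cut_facet :: "'d \<Rightarrow> 'd vertex set" where
  "cut_facet k = {v. v \<noteq> Peak \<and> (\<forall>j. v = Corner j \<longrightarrow> j = k)}"

definition side_facet :: "'d \<Rightarrow> 'd \<Rightarrow> 'd vertex set" where
  "side_facet m i = {v. v \<noteq> Corner i \<and> v \<noteq> Cut i \<and> (v = Peak \<longrightarrow> i = m)}"

definition peak_facet :: "'d \<Rightarrow> 'd \<Rightarrow> 'd vertex set" where
  "peak_facet k i = {v. v \<noteq> Corner i \<and> (\<forall>j. v = Cut j \<longrightarrow> j = k \<and> j \<noteq> i)}"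

text \<open>The cut is \<open>x\<^sub>k + 2 (\<Sum>j\<noteq>k. x\<^sub>j) \<ge> 1\<close>, and the facet through the peak opposite to \<open>e\<^sub>i\<close> is
  \<open>(3 - d) x\<^sub>i + (\<Sum>j\<noteq>i. x\<^sub>j) \<le> 1\<close>. The coefficient \<open>3 - d\<close> makes the peak satisfy this with equality; it is less
  than \<open>1\<close>, so \<open>e\<^sub>i\<close> satisfies it strictly. For \<open>i = m\<close> the peak lies in \<open>x\<^sub>i = 0\<close>, so there is no
  such facet.\<close>

lemma facets_in_face_vertex_sets:
  fixes m k :: "'d::finite"
  assumes d: "CARD('d) \<ge> 3"
  shows "cut_facet k \<in> face_vertex_sets m k"
    and "side_facet m i \<in> face_vertex_sets m k"
    and "i \<noteq> m \<Longrightarrow> peak_facet k i \<in> face_vertex_sets m k"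
proof -
  define r where "r = real CARD('d)"
  have r: "r \<ge> 3" using d by (simp add: r_def)
  have card: "real (card (-{m})) = r - 1"
    using d by (simp add: r_def card_Compl_singleton of_nat_diff)
  show "cut_facet k \<in> face_vertex_sets m k"
  proof -
    define a :: "real ^ 'd" where "a = (\<chi> i. if i = k then - 1 else - 2)"
    have "(\<Sum>j\<in>-{m}. a $ j) \<le> (\<Sum>j\<in>-{m}. - 1)" by (rule sum_mono) (simp add: a_def)
    then have "(\<Sum>j\<in>-{m}. a $ j) < - 1" using r by (simp add: card)
    then have "a \<bullet> position m k v \<le> - 1 \<and> (v \<in> cut_facet k \<longleftrightarrow> a \<bullet> position m k v = - 1)" for v
      by (cases v) (auto simp: cut_facet_def a_def)
    then show ?thesis unfolding face_vertex_sets_def by blast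
  qed
  show "side_facet m i \<in> face_vertex_sets m k"
  proof -
    define a :: "real ^ 'd" where "a = - axis i 1"
    have a: "a $ j = (if j = i then - 1 else 0)" for j by (simp add: a_def axis_def)
    have "a \<bullet> position m k v \<le> 0 \<and> (v \<in> side_facet m i \<longleftrightarrow> a \<bullet> position m k v = 0)" for v
      by (cases v) (auto simp: side_facet_def a)
    then show ?thesis unfolding face_vertex_sets_def by blast
  qed
  show "peak_facet k i \<in> face_vertex_sets m k" if i: "i \<noteq> m"
  proof -
    define a :: "real ^ 'd" where "a = (\<chi> j. if j = i then 3 - r else 1)"
    have "(\<Sum>j\<in>-{m}. a $ j) = (\<Sum>j\<in>-{m}. 1 + (if j = i then 2 - r else 0))"
      by (simp add: a_def) (rule sum.cong, auto)
    also have "\<dots> = 1" using i by (simp add: sum.distrib card)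
    finally have "a \<bullet> position m k v \<le> 1 \<and> (v \<in> peak_facet k i \<longleftrightarrow> a \<bullet> position m k v = 1)" for v
      using r by (cases v) (auto simp: peak_facet_def a_def)
    then show ?thesis unfolding face_vertex_sets_def by blast
  qed
qed

text \<open>A cell with index set \<open>J\<close> lies on the facets belonging to indices outside \<open>J\<close>. If \<open>J\<close> is neither
  everything nor \<open>-{m}\<close>, one of these indices differs from \<open>m\<close>; its coordinate facet excludes the
  peak, and its facet through the peak excludes the cut points.\<close>

lemma cell_is_face_vertex_set:
  fixes m k :: "'d::finite"
  assumes d: "CARD('d) \<ge> 3" and "cell m k X n"
  shows "saturate k X \<in> face_vertex_sets m k"
proof -
  note facets = facets_in_face_vertex_sets[OF d]
  note INT = face_vertex_sets_INT[OF finite]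
  have other: "\<exists>i. i \<notin> J \<and> i \<noteq> m" if "J \<noteq> UNIV" "J \<noteq> -{m}" for J using that by auto
  show ?thesis
    using assms(2)
  proof cases
    case (cut J)
    have "saturate k X = cut_facet k \<inter> (\<Inter>i\<in>-J. side_facet m i)"
    proof (rule set_eqI)
      show "v \<in> saturate k X \<longleftrightarrow> v \<in> cut_facet k \<inter> (\<Inter>i\<in>-J. side_facet m i)" for v
        by (cases v) (auto simp: cut saturate_def cut_facet_def side_facet_def)
    qed
    then show ?thesis by (auto intro!: face_vertex_sets_Int INT facets)
  next
    case (corner J)
    have "saturate k X = (\<Inter>i\<in>-J. side_facet m i) \<inter> (\<Inter>i\<in>-J-{m}. peak_facet k i)"
    proof (rule set_eqI)
      show "v \<in> saturate k X \<longleftrightarrow>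
          v \<in> (\<Inter>i\<in>-J. side_facet m i) \<inter> (\<Inter>i\<in>-J-{m}. peak_facet k i)" for v
        using other[OF corner(3,4)]
        by (cases v) (auto simp: corner saturate_def peak_facet_def side_facet_def)
    qed
    then show ?thesis by (auto intro!: face_vertex_sets_Int INT facets)
  next
    case (wall J)
    have "saturate k X = (\<Inter>i\<in>-J. side_facet m i)"
    proof (rule set_eqI)
      show "v \<in> saturate k X \<longleftrightarrow> v \<in> (\<Inter>i\<in>-J. side_facet m i)" for v
        using other[OF wall(5,6)] by (cases v) (auto simp: wall saturate_def side_facet_def)
    qed
    then show ?thesis by (auto intro!: INT facets)
  next
    case (cone J)
    have "saturate k X = (\<Inter>i\<in>-J\<inter>{m}. side_facet m i) \<inter> (\<Inter>i\<in>-J-{m}. peak_facet k i)"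
    proof (rule set_eqI)
      show "v \<in> saturate k X \<longleftrightarrow>
          v \<in> (\<Inter>i\<in>-J\<inter>{m}. side_facet m i) \<inter> (\<Inter>i\<in>-J-{m}. peak_facet k i)" for v
        using other[OF cone(3,4)]
        by (cases v; cases "k = m") (auto simp: cone saturate_def peak_facet_def side_facet_def)
    qed
    then show ?thesis by (auto intro!: face_vertex_sets_Int INT facets)
  next
    case large
    have "saturate k X = side_facet m m"
    proof (rule set_eqI)
      show "v \<in> saturate k X \<longleftrightarrow> v \<in> side_facet m m" for v
        by (cases v) (auto simp: large saturate_def side_facet_def)
    qed
    then show ?thesis by (simp add: facets)
  qed
qed

section \<open>Dimensions of the faces\<close>

lemma independent_scaled_axes:
  fixes c :: "'d::finite \<Rightarrow> real"
  assumes "\<And>j. j \<in> J \<Longrightarrow> c j \<noteq> 0"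
  shows "independent ((\<lambda>j. axis j (c j)) ` J)" "card ((\<lambda>j. axis j (c j)) ` J) = card J"
proof -
  show "independent ((\<lambda>j. axis j (c j)) ` J)"
    using assms by (intro pairwise_orthogonal_independent)
      (auto simp: pairwise_def orthogonal_def inner_axis_axis axis_eq_0_iff)
  have "inj_on (\<lambda>j. axis j (c j)) J"
    using assms by (auto intro!: inj_onI simp: axis_eq_axis)
  then show "card ((\<lambda>j. axis j (c j)) ` J) = card J" by (rule card_image)
qed

lemma aff_dim_scaled_axes:
  fixes c :: "'d::finite \<Rightarrow> real"
  assumes "\<And>j. j \<in> J \<Longrightarrow> c j \<noteq> 0"
  shows "aff_dim ((\<lambda>j. axis j (c j)) ` J) = int (card J) - 1"
proof -
  have "independent ((\<lambda>j. axis j (c j)) ` J)" and card: "card ((\<lambda>j. axis j (c j)) ` J) = card J"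
    by (rule independent_scaled_axes; fact assms)+
  then have "\<not> affine_dependent ((\<lambda>j. axis j (c j)) ` J)"
    by (metis affine_dependent_imp_dependent)
  from aff_dim_affine_independent[OF this] card show ?thesis by simp
qed

text \<open>Used for the faces, the whole polytope included, whose affine hull contains the origin although
  the origin has been cut off: those containing a corner and a cut point on the line through it.\<close>

lemma aff_dim_coordinate_subspace:
  fixes S :: "(real ^ 'd::finite) set"
  assumes "0 \<in> affine hull S" "\<And>j. j \<in> J \<Longrightarrow> axis j 1 \<in> S"
    and "\<And>x i. x \<in> S \<Longrightarrow> i \<notin> J \<Longrightarrow> x $ i = 0"
  shows "aff_dim S = int (card J)"
proof -
  have "x \<in> span ((\<lambda>j. axis j 1) ` J)" if "x \<in> S" for x
  proof -
    have "x = (\<Sum>j\<in>J. (x $ j) *\<^sub>R axis j 1)"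
      using assms(3)[OF that] by (auto simp: vec_eq_iff axis_def if_distrib cong: if_cong)
    also have "\<dots> \<in> span ((\<lambda>j. axis j 1) ` J)"
      by (intro span_sum span_scale span_base) auto
    finally show ?thesis .
  qed
  then have "dim S = card J"
    using assms(2) independent_scaled_axes[of J "\<lambda>_. 1"]
    by (intro dim_unique[of "(\<lambda>j. axis j 1) ` J"]) auto
  then show ?thesis using assms(1) by (simp add: aff_dim_zero)
qed

lemma zero_in_affine_hull:
  assumes "j \<noteq> k" "Corner j \<in> S" "Cut j \<in> S"
  shows "0 \<in> affine hull (position m k ` S)"
proof -
  have "2 *\<^sub>R position m k (Cut j) + (- 1) *\<^sub>R position m k (Corner j)
      \<in> affine hull (position m k ` S)"
    by (rule mem_affine) (auto simp: assms hull_inc)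
  moreover have "2 *\<^sub>R position m k (Cut j) + (- 1) *\<^sub>R position m k (Corner j) = 0"
    using assms(1) by (simp add: position_def vec_eq_iff axis_def)
  ultimately show ?thesis by simp
qed

lemma aff_dim_cell:
  fixes m k :: "'d::finite"
  assumes d: "CARD('d) \<ge> 3" and "cell m k X n"
  shows "aff_dim (position m k ` X) = int n"
  using assms(2)
proof cases
  case (cut J)
  have "position m k ` X = (\<lambda>j. axis j (if j = k then 1 else 1 / 2)) ` J"
    by (auto simp: cut position_def image_image intro!: image_cong)
  then show ?thesis
    using cut aff_dim_scaled_axes[of J "\<lambda>j. if j = k then 1 else 1 / 2"] by simp
next
  case (corner J)
  have "position m k ` X = (\<lambda>j. axis j 1) ` J"
    by (auto simp: corner position_def image_image intro!: image_cong)
  then show ?thesis using corner by (simp add: aff_dim_scaled_axes)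
next
  case (wall J)
  then obtain j where "j \<in> J" "j \<noteq> k" by blast
  then have "aff_dim (position m k ` X) = int (card J)"
  proof (intro aff_dim_coordinate_subspace)
    show "0 \<in> affine hull (position m k ` X)"
      using \<open>j \<in> J\<close> \<open>j \<noteq> k\<close> wall by (intro zero_in_affine_hull[of j]) auto
    show "axis i 1 \<in> position m k ` X" if "i \<in> J" for i
      using that wall by (intro rev_image_eqI[of "Corner i"]) (auto simp: position_def)
    show "x $ i = 0" if "x \<in> position m k ` X" "i \<notin> J" for x i
      using that wall by (auto simp: position_nth split: if_splits)
  qed
  then show ?thesis using wall by simp
next
  case (cone J)
  have eq: "position m k ` X = insert (position m k Peak) ((\<lambda>j. axis j 1) ` J)"
    by (auto simp: cone position_def image_image intro!: image_cong)
  \<comment> \<open>The coordinates of a corner add up to \<open>1\<close>, those of the peak to \<open>d - 1\<close>.\<close>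
  have "affine hull ((\<lambda>j. axis j (1::real)) ` J) \<subseteq> {x. (\<chi> i. 1) \<bullet> x = 1}"
    by (rule hull_minimal) (auto simp: affine_hyperplane inner_axis)
  moreover have "(\<chi> i. 1) \<bullet> position m k Peak = real (CARD('d) - 1)"
    by (simp add: card_Compl_singleton)
  ultimately have "position m k Peak \<notin> affine hull ((\<lambda>j. axis j 1) ` J)"
    using d by auto
  then show ?thesis unfolding eq using cone by (simp add: aff_dim_insert aff_dim_scaled_axes)
next
  case large
  obtain t where "t \<noteq> m" "t \<noteq> k" using third_index[OF d] by blast
  then have "aff_dim (position m k ` X) = int (card (-{m}))"
  proof (intro aff_dim_coordinate_subspace)
    show "0 \<in> affine hull (position m k ` X)"
      using \<open>t \<noteq> m\<close> \<open>t \<noteq> k\<close> large by (intro zero_in_affine_hull[of t]) auto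
    show "axis i 1 \<in> position m k ` X" if "i \<in> -{m}" for i
      using that large by (intro rev_image_eqI[of "Corner i"]) (auto simp: position_def)
    show "x $ i = 0" if "x \<in> position m k ` X" "i \<notin> -{m}" for x i
      using that large by (auto simp: position_nth split: if_splits)
  qed
  then show ?thesis using large by (simp add: card_Compl_singleton)
qed

lemma full_polytope_cut_stacked_simplex:
  fixes m k :: "'d::finite"
  assumes d: "CARD('d) \<ge> 3"
  shows "full_polytope (cut_stacked_simplex m k)"
proof -
  obtain t where "t \<noteq> k" using third_index[OF d] by blast
  then have "aff_dim (range (position m k)) = int CARD('d)"
    using zero_in_affine_hull[of t k UNIV m]
    by (intro aff_dim_coordinate_subspace)
      (auto simp: position_def intro: rev_image_eqI[of "Corner _"])
  then have "affine hull cut_stacked_simplex m k = UNIV"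
    by (simp add: cut_stacked_simplex_def flip: aff_dim_eq_full)
  then show ?thesis
    unfolding full_polytope_def cut_stacked_simplex_def by (simp add: polytope_convex_hull)
qed

lemma skeleton_cut_stacked_simplex:
  fixes m k :: "'d::finite"
  assumes d: "CARD('d) \<ge> 3" and b: "b < CARD('d)"
  shows "skeleton a b (cut_stacked_simplex m k) =
    (\<lambda>X. convex hull (position m k ` X)) ` {X. \<exists>n. cell m k X n \<and> a \<le> n \<and> n \<le> b}"
    (is "_ = ?hull ` ?cells")
proof (intro subset_antisym subsetI)
  have faces: "faces (cut_stacked_simplex m k) = ?hull ` face_vertex_sets m k"
    using faces_eq_face_of[OF full_polytope_cut_stacked_simplex[OF d]]
      face_of_cut_stacked_simplex_iff by blast
  {
    fix F assume "F \<in> skeleton a b (cut_stacked_simplex m k)"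
    then obtain n where n: "a \<le> n" "n \<le> b" "F \<in> faces (cut_stacked_simplex m k)" "aff_dim F = int n"
      by (auto simp: skeleton_def k_faces_def)
    then obtain S where S: "S \<in> face_vertex_sets m k" "F = ?hull S" using faces by blast
    have "aff_dim (cut_stacked_simplex m k) = int CARD('d)"
      using full_polytope_cut_stacked_simplex[OF d, of m k]
      by (simp add: full_polytope_def flip: aff_dim_eq_full)
    then have "S \<noteq> UNIV" using S(2) n(2,4) b by (auto simp: cut_stacked_simplex_def)
    moreover have "S \<noteq> {}" using S(2) n(4) by auto
    ultimately obtain X n' where X: "cell m k X n'" "S = saturate k X"
      using face_vertex_set_is_cell[OF d S(1)] by blast
    then have F: "F = ?hull X" by (simp add: S(2) position_saturate)
    then have "n' = n" using aff_dim_cell[OF d X(1)] n(4) by (simp add: aff_dim_convex_hull)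
    then show "F \<in> ?hull ` ?cells" using F X(1) n(1,2) by blast
  next
    fix F assume "F \<in> ?hull ` ?cells"
    then obtain X n where X: "cell m k X n" "a \<le> n" "n \<le> b" "F = ?hull X" by blast
    then have "F \<in> faces (cut_stacked_simplex m k)"
      using cell_is_face_vertex_set[OF d X(1)] position_saturate faces by (metis image_eqI)
    moreover have "aff_dim F = int n" using aff_dim_cell[OF d X(1)] X(4)
      by (simp add: aff_dim_convex_hull)
    ultimately show "F \<in> skeleton a b (cut_stacked_simplex m k)"
      using X(2,3) by (auto simp: skeleton_def k_faces_def)
  }
qed

lemma cell_hull_subset_iff:
  fixes m k :: "'d::finite"
  assumes "CARD('d) \<ge> 3" "cell m k X n" "cell m k Y n'"
  shows "convex hull (position m k ` X) \<subseteq> convex hull (position m k ` Y)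
    \<longleftrightarrow> saturate k X \<subseteq> saturate k Y"
  using convex_hull_face_vertex_sets_subset_iff[OF cell_is_face_vertex_set[OF assms(1,2)]
      cell_is_face_vertex_set[OF assms(1,3)]]
  by (simp add: position_saturate)

section \<open>The skeleton of dimensions up to d - 3\<close>

text \<open>The labels only preorder the faces, since different label sets may give the same face, so the
  isomorphism is obtained from two monotone images of one index set, without assuming either map
  injective.\<close>

lemma poset_isomorphic_images:
  assumes "\<And>x y. x \<in> A \<Longrightarrow> y \<in> A \<Longrightarrow> f x \<le> f y \<longleftrightarrow> g x \<le> g y"
  shows "poset_isomorphic (f ` A) (g ` A)"
proof -
  define h where "h = (\<lambda>u. g (inv_into A f u))"
  have h: "h (f x) = g x" if "x \<in> A" for x
  proof -
    have "inv_into A f (f x) \<in> A" "f (inv_into A f (f x)) = f x"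
      using that by (auto simp: inv_into_into f_inv_into_f)
    then show ?thesis unfolding h_def using assms that by (metis antisym order_refl)
  qed
  have "inj_on h (f ` A)"
    using h assms by (auto intro!: inj_onI) (metis antisym order_refl)
  moreover have "h ` f ` A = g ` A" using h by (auto simp: image_image)
  ultimately show ?thesis
    unfolding poset_isomorphic_def bij_betw_def using h assms by (intro exI[of _ h]) auto
qed

text \<open>In the lowest \<open>d - 2\<close> dimensions the index sets are too small for the exceptions
  \<open>UNIV\<close> and \<open>-{m}\<close> to occur.\<close>

lemma low_cell_independent:
  fixes m k :: "'d::finite"
  assumes "cell m k X n" "n + 3 \<le> CARD('d)"
  shows "cell m' k X n"
proof -
  have big: "J \<noteq> UNIV" "J \<noteq> -{i}" if "card J + 2 \<le> CARD('d)" for J and i :: 'd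
    using that by (auto simp: card_Compl_singleton)
  show ?thesis using assms(1)
  proof cases
    case (cut J) then show ?thesis by (auto intro: cell.cut)
  next
    case (corner J) then show ?thesis using assms(2) big[of J] by (auto intro: cell.corner)
  next
    case (wall J) then show ?thesis using assms(2) big[of J] by (auto intro: cell.wall)
  next
    case (cone J) then show ?thesis using assms(2) big[of J] by (auto intro: cell.cone)
  next
    case large then show ?thesis using assms(2) by auto
  qed
qed

lemma low_skeleton_isomorphic:
  fixes m m' k :: "'d::finite"
  assumes d: "CARD('d) \<ge> 3"
  shows "poset_isomorphic (skeleton 0 (CARD('d) - 3) (cut_stacked_simplex m k))
    (skeleton 0 (CARD('d) - 3) (cut_stacked_simplex m' k))"
proof -
  let ?cells = "\<lambda>m. {X. \<exists>n. cell m k X n \<and> 0 \<le> n \<and> n \<le> CARD('d) - 3}"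
  have low: "n + 3 \<le> CARD('d) \<longleftrightarrow> n \<le> CARD('d) - 3" for n using d by auto
  have eq: "?cells m = ?cells m'" using low_cell_independent low by blast
  have "poset_isomorphic ((\<lambda>X. convex hull (position m k ` X)) ` ?cells m)
      ((\<lambda>X. convex hull (position m' k ` X)) ` ?cells m)"
  proof (rule poset_isomorphic_images)
    fix X Y assume "X \<in> ?cells m" "Y \<in> ?cells m"
    moreover from this have "X \<in> ?cells m'" "Y \<in> ?cells m'" using eq by blast+
    ultimately show "convex hull (position m k ` X) \<subseteq> convex hull (position m k ` Y)
        \<longleftrightarrow> convex hull (position m' k ` X) \<subseteq> convex hull (position m' k ` Y)"
      using cell_hull_subset_iff[OF d] by blast
  qed
  moreover have "CARD('d) - 3 < CARD('d)" using d by simp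
  ultimately show ?thesis using eq by (simp add: skeleton_cut_stacked_simplex[OF d])
qed


section \<open>The skeleton of dimensions from two\<close>

text \<open>A cell of dimension at least two that contains a label of \<open>e\<^sub>k\<close> also contains a label of the same
  kind, corner or cut point, with another index. A cell with a corner other than \<open>e\<^sub>k\<close> that contains \<open>Cut k\<close>
  contains \<open>Corner k\<close> too, and vice versa; so the extra label supplied by saturation cannot create
  a new inclusion.\<close>

lemma saturate_subset_iff:
  fixes m k :: "'d::finite"
  assumes X: "cell m k X n" "n \<ge> 2" and Y: "cell m k Y n'"
  shows "saturate k X \<subseteq> saturate k Y \<longleftrightarrow> X \<subseteq> Y"
proof
  have other: "\<exists>j\<in>J. j \<noteq> k" if "card J \<ge> 2" for J
  proof (rule ccontr)
    assume "\<not> (\<exists>j\<in>J. j \<noteq> k)"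
    then have "J \<subseteq> {k}" by blast
    then have "card J \<le> 1" using card_mono[of "{k}" J] by simp
    then show False using that by simp
  qed
  have mates: "(Corner k \<in> X \<longrightarrow> (\<exists>j. j \<noteq> k \<and> Corner j \<in> X)) \<and>
      (Cut k \<in> X \<longrightarrow> (\<exists>j. j \<noteq> k \<and> Cut j \<in> X))"
    using X
  proof cases
    case (cut J) then show ?thesis using other[of J] X(2) by auto
  next
    case (corner J) then show ?thesis using other[of J] X(2) by auto
  next
    case (wall J) then show ?thesis using other[of J] X(2) by auto
  next
    case (cone J) then show ?thesis using other[of J] X(2) by auto
  next
    case large
    have "card (-{m}) \<ge> 2" using large X(2) by (simp add: card_Compl_singleton)
    from other[OF this] show ?thesis using large by auto
  qed
  have both: "Corner k \<in> Y" if "Corner j \<in> Y" "Cut k \<in> Y" for j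
    using Y that by cases auto
  have both': "Cut k \<in> Y" if "Cut j \<in> Y" "Corner k \<in> Y" for j
    using Y that by cases auto
  assume sub: "saturate k X \<subseteq> saturate k Y"
  have away: "v \<in> Y" if "v \<in> X" "v \<noteq> Corner k" "v \<noteq> Cut k" for v
    using sub that unfolding saturate_def by (auto split: if_splits)
  show "X \<subseteq> Y"
  proof
    fix v assume v: "v \<in> X"
    have touch: "Corner k \<in> Y \<or> Cut k \<in> Y" if "v = Corner k \<or> v = Cut k"
      using sub v that unfolding saturate_def by (auto split: if_splits)
    consider "v = Corner k" | "v = Cut k" | "v \<noteq> Corner k" "v \<noteq> Cut k" by blast
    then show "v \<in> Y"
    proof cases
      case 1
      then obtain j where "j \<noteq> k" "Corner j \<in> X" using mates v by blast
      then show ?thesis using away[of "Corner j"] both[of j] touch 1 by auto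
    next
      case 2
      then obtain j where "j \<noteq> k" "Cut j \<in> X" using mates v by blast
      then show ?thesis using away[of "Cut j"] both'[of j] touch 2 by auto
    next
      case 3
      then show ?thesis using away v by blast
    qed
  qed
qed (auto simp: saturate_def)

text \<open>From dimension two upwards \<open>k\<close> has vanished from the list, so any permutation of the indices
  that moves \<open>m\<close> may be applied to it with \<open>k\<close> held fixed.\<close>

lemma cell_relabel:
  fixes m k :: "'d::finite"
  assumes "bij \<pi>" "cell m k X n" "n \<ge> 2"
  shows "cell (\<pi> m) k (map_vertex \<pi> ` X) n"
proof -
  have inj: "inj \<pi>" using assms(1) by (rule bij_is_inj)
  have card: "card (\<pi> ` J) = card J" for J using inj by (meson card_image inj_on_subset subset_UNIV)
  have neq: "\<pi> ` J \<noteq> UNIV" if "J \<noteq> UNIV" for J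
    using that assms(1) by (metis bij_betw_def inj_image_eq_iff)
  have compl: "\<pi> ` (-{i}) = -{\<pi> i}" for i using assms(1) by (simp add: bij_image_Compl_eq)
  have neq': "\<pi> ` J \<noteq> -{\<pi> m}" if "J \<noteq> -{m}" for J
    using that compl[of m] inj by (metis inj_image_eq_iff)
  have img: "map_vertex \<pi> ` Corner ` J = Corner ` \<pi> ` J" "map_vertex \<pi> ` Cut ` J = Cut ` \<pi> ` J" for J
    by (simp_all add: image_image)
  show ?thesis using assms(2)
  proof cases
    case (cut J)
    then show ?thesis by (auto simp: img card intro!: cell.cut)
  next
    case (corner J)
    then show ?thesis
      using neq[of J] neq'[of J] by (simp only: img) (intro cell.corner, simp_all add: card)
  next
    case (wall J)
    moreover have "\<pi> ` J \<noteq> {k}" using card[of J] wall assms(3) by auto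
    ultimately show ?thesis
      using neq[of J] neq'[of J]
      by (simp only: img image_Un) (intro cell.wall, simp_all add: card)
  next
    case (cone J)
    then show ?thesis
      using neq[of J] neq'[of J]
      by (simp only: img image_insert vertex.map) (intro cell.cone, simp_all add: card)
  next
    case large
    then show ?thesis using cell.large[of "\<pi> m" k] by (simp add: img image_Un compl)
  qed
qed

lemma upper_skeleton_isomorphic:
  fixes m m' k :: "'d::finite"
  assumes d: "CARD('d) \<ge> 3"
  shows "poset_isomorphic (skeleton 2 (CARD('d) - 1) (cut_stacked_simplex m k))
    (skeleton 2 (CARD('d) - 1) (cut_stacked_simplex m' k))"
proof -
  let ?cells = "\<lambda>m. {X. \<exists>n. cell m k X n \<and> 2 \<le> n \<and> n \<le> CARD('d) - 1}"
  define \<pi> where "\<pi> = Transposition.transpose m m'"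
  define \<rho> where "\<rho> = map_vertex \<pi>"
  have \<pi>: "bij \<pi>" "\<pi> m = m'" "\<pi> m' = m" "\<pi> \<circ> \<pi> = id"
    by (auto simp: \<pi>_def)
  have \<rho>\<rho>: "\<rho> (\<rho> v) = v" for v
    by (simp add: \<rho>_def vertex.map_comp \<pi>(4) vertex.map_id)
  then have inj: "inj \<rho>" by (metis injI)
  have into: "\<rho> ` X \<in> ?cells m'" if "X \<in> ?cells m" for X
    using that cell_relabel[OF \<pi>(1), of m] by (auto simp: \<rho>_def \<pi>(2))
  have into_back: "\<rho> ` X \<in> ?cells m" if "X \<in> ?cells m'" for X
    using that cell_relabel[OF \<pi>(1), of m'] by (auto simp: \<rho>_def \<pi>(3))
  have surj: "(`) \<rho> ` ?cells m = ?cells m'"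
  proof (intro subset_antisym subsetI)
    fix Y assume Y: "Y \<in> ?cells m'"
    have "Y = \<rho> ` \<rho> ` Y" by (simp add: image_image \<rho>\<rho>)
    then show "Y \<in> (`) \<rho> ` ?cells m" using into_back[OF Y] by blast
  qed (use into in blast)
  have order: "convex hull (position m k ` X) \<subseteq> convex hull (position m k ` Y) \<longleftrightarrow> X \<subseteq> Y"
    if "X \<in> ?cells m" "Y \<in> ?cells m" for X Y m
  proof -
    from that obtain n n' where "cell m k X n" "2 \<le> n" "cell m k Y n'" by blast
    then show ?thesis using cell_hull_subset_iff[OF d] saturate_subset_iff by metis
  qed
  have "poset_isomorphic ((\<lambda>X. convex hull (position m k ` X)) ` ?cells m)
      ((\<lambda>X. convex hull (position m' k ` \<rho> ` X)) ` ?cells m)"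
  proof (rule poset_isomorphic_images)
    fix X Y assume XY: "X \<in> ?cells m" "Y \<in> ?cells m"
    show "convex hull (position m k ` X) \<subseteq> convex hull (position m k ` Y)
        \<longleftrightarrow> convex hull (position m' k ` \<rho> ` X) \<subseteq> convex hull (position m' k ` \<rho> ` Y)"
      unfolding order[OF XY] order[OF into[OF XY(1)] into[OF XY(2)]]
      using inj by (simp add: inj_image_subset_iff)
  qed
  moreover have "(\<lambda>X. convex hull (position m' k ` \<rho> ` X)) ` ?cells m
      = (\<lambda>X. convex hull (position m' k ` X)) ` ?cells m'"
    unfolding surj[symmetric] by (simp add: image_image)
  moreover have "CARD('d) - 1 < CARD('d)" using d by simp
  ultimately show ?thesis by (simp add: skeleton_cut_stacked_simplex[OF d])
qed

section \<open>Telling the face lattices apart\<close>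

text \<open>An order-theoretic trace of being a pyramid: \<open>x\<close> plays the role of the base and \<open>y\<close> that of the
  apex. The first two conditions say that \<open>x\<close> is not the top and \<open>y\<close> not the bottom element, without
  referring to such elements, so that the property is visibly invariant under isomorphisms.\<close>

definition pyramidal :: "'a::order set \<Rightarrow> bool" where
  "pyramidal L \<longleftrightarrow> (\<exists>x\<in>L. \<exists>y\<in>L. (\<exists>z\<in>L. \<not> z \<le> x) \<and> (\<exists>z\<in>L. \<not> y \<le> z) \<and> (\<forall>z\<in>L. z \<le> x \<or> y \<le> z))"

lemma pyramidal_isomorphic:
  assumes "poset_isomorphic A B" "pyramidal A"
  shows "pyramidal B"
proof -
  obtain f where f: "f ` A = B" "\<And>x y. x \<in> A \<Longrightarrow> y \<in> A \<Longrightarrow> x \<le> y \<longleftrightarrow> f x \<le> f y"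
    using assms(1) unfolding poset_isomorphic_def bij_betw_def by blast
  show ?thesis
    using assms(2) unfolding pyramidal_def f(1)[symmetric] bex_simps ball_simps
    by (simp add: f(2) cong: bex_cong ball_cong)
qed

lemma pyramidal_faces_iff:
  fixes m k :: "'d::finite"
  assumes d: "CARD('d) \<ge> 3"
  shows "pyramidal (faces (cut_stacked_simplex m k)) \<longleftrightarrow> pyramidal (face_vertex_sets m k)"
proof -
  let ?hull = "\<lambda>S. convex hull (position m k ` S)"
  have faces: "faces (cut_stacked_simplex m k) = ?hull ` face_vertex_sets m k"
    using faces_eq_face_of[OF full_polytope_cut_stacked_simplex[OF d]]
      face_of_cut_stacked_simplex_iff by blast
  have "poset_isomorphic (?hull ` face_vertex_sets m k) ((\<lambda>S. S) ` face_vertex_sets m k)"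
    "poset_isomorphic ((\<lambda>S. S) ` face_vertex_sets m k) (?hull ` face_vertex_sets m k)"
    using convex_hull_face_vertex_sets_subset_iff by (intro poset_isomorphic_images; blast)+
  then show ?thesis using pyramidal_isomorphic unfolding faces by (metis image_ident)
qed

lemma pyramidal_face_vertex_sets_iff:
  "pyramidal (face_vertex_sets m k) \<longleftrightarrow>
    (\<exists>S\<in>face_vertex_sets m k. \<exists>T\<in>face_vertex_sets m k. S \<noteq> UNIV \<and> T \<noteq> {} \<and>
      (\<forall>R\<in>face_vertex_sets m k. R \<subseteq> S \<or> T \<subseteq> R))"
proof -
  have "(\<exists>R\<in>face_vertex_sets m k. \<not> R \<subseteq> S) \<longleftrightarrow> S \<noteq> UNIV" for S
    using face_vertex_sets_UNIV[of m k] by auto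
  moreover have "(\<exists>R\<in>face_vertex_sets m k. \<not> T \<subseteq> R) \<longleftrightarrow> T \<noteq> {}" for T
    using face_vertex_sets_empty[of m k] by auto
  ultimately show ?thesis unfolding pyramidal_def by simp
qed

text \<open>The base is the large facet in \<open>x\<^sub>k = 0\<close>, and the apex is \<open>e\<^sub>k\<close>.\<close>

lemma pyramidal_cut_stacked_simplex:
  fixes k :: "'d::finite"
  assumes d: "CARD('d) \<ge> 3"
  shows "pyramidal (face_vertex_sets k k)"
proof -
  have "side_facet k k \<in> face_vertex_sets k k" by (rule facets_in_face_vertex_sets[OF d])
  moreover have "{Corner k, Cut k} \<in> face_vertex_sets k k"
  proof -
    have "cell k k (Cut ` {k}) 0" by (rule cell.cut) simp
    from cell_is_face_vertex_set[OF d this] show ?thesis by (simp add: saturate_def insert_commute)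
  qed
  moreover have "S \<subseteq> side_facet k k \<or> {Corner k, Cut k} \<subseteq> S" if "S \<in> face_vertex_sets k k" for S
    using face_vertex_sets_closure(1)[OF d that] by (auto simp: side_facet_def)
  moreover have "side_facet k k \<noteq> UNIV" by (auto simp: side_facet_def)
  ultimately show ?thesis
    unfolding pyramidal_face_vertex_sets_iff
    by (intro bexI[of _ "side_facet k k"] bexI[of _ "{Corner k, Cut k}"]) auto
qed

text \<open>Any vertex outside the base \<open>S\<close> is a face not contained in \<open>S\<close>, hence contains the apex \<open>T\<close>, hence
  equals it. But going through the list of cells one finds two different vertices outside each of
  them; for the large facet these are \<open>Corner m\<close> and \<open>Cut m\<close>, which coincide only for \<open>m = k\<close>.\<close>

lemma not_pyramidal_cut_stacked_simplex:
  fixes m k :: "'d::finite"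
  assumes d: "CARD('d) \<ge> 3" and "m \<noteq> k"
  shows "\<not> pyramidal (face_vertex_sets m k)"
proof
  assume "pyramidal (face_vertex_sets m k)"
  then obtain S T where ST: "S \<in> face_vertex_sets m k" "S \<noteq> UNIV" "T \<noteq> {}"
    and split: "\<And>R. R \<in> face_vertex_sets m k \<Longrightarrow> R \<subseteq> S \<or> T \<subseteq> R"
    unfolding pyramidal_face_vertex_sets_iff by blast
  have vertex: "saturate k {v} \<in> face_vertex_sets m k" for v
  proof -
    obtain t where t: "t \<noteq> m" "t \<noteq> k" using third_index[OF d] by blast
    have "\<exists>X n. cell m k X n \<and> saturate k X = saturate k {v}"
    proof (cases v)
      case Peak
      have "cell m k (insert Peak (Corner ` {})) 0"
        using t by (intro cell.cone) auto
      then show ?thesis using Peak by auto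
    next
      case (Corner j)
      have "card {j} \<noteq> card (-{m})" "card {j} \<noteq> CARD('d)"
        using d by (simp_all add: card_Compl_singleton)
      then have "{j} \<noteq> -{m}" "{j} \<noteq> UNIV" by metis+
      then have "cell m k (Corner ` {j}) 0" by (intro cell.corner) auto
      then show ?thesis using Corner by auto
    next
      case (Cut j)
      have "cell m k (Cut ` {j}) 0" by (intro cell.cut) auto
      then show ?thesis using Cut by auto
    qed
    then show ?thesis using cell_is_face_vertex_set[OF d] by metis
  qed
  have small: "saturate k {v} = saturate k {w}" if "v \<notin> S" "w \<notin> S" for v w
  proof -
    have "T \<subseteq> saturate k {v}" "T \<subseteq> saturate k {w}"
      using split[OF vertex[of v]] split[OF vertex[of w]] that by (auto simp: saturate_def)
    moreover have "x \<in> saturate k {u} \<Longrightarrow> saturate k {u} = saturate k {x}" for x u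
      by (auto simp: saturate_def split: if_splits)
    ultimately show ?thesis using ST(3) by (metis all_not_in_conv subsetD)
  qed
  have missing: "\<exists>v w. v \<notin> S \<and> w \<notin> S \<and> saturate k {v} \<noteq> saturate k {w}"
  proof (cases "S = {}")
    case True
    then show ?thesis by (intro exI[of _ Peak] exI[of _ "Corner k"]) (auto simp: saturate_def)
  next
    case False
    then obtain X n where X: "cell m k X n" and S: "S = saturate k X"
      using face_vertex_set_is_cell[OF d ST(1)] ST(2) by blast
    obtain t where t: "t \<noteq> m" "t \<noteq> k" using third_index[OF d] by blast
    show ?thesis using X
    proof cases
      case (cut J)
      then show ?thesis using t
        by (intro exI[of _ Peak] exI[of _ "Corner t"]) (auto simp: S saturate_def)
    next
      case (corner J)
      then show ?thesis using t
        by (intro exI[of _ Peak] exI[of _ "Cut t"]) (auto simp: S saturate_def)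
    next
      case (wall J)
      then obtain i where "i \<notin> J" by blast
      then show ?thesis using wall
        by (intro exI[of _ Peak] exI[of _ "Corner i"]) (auto simp: S saturate_def)
    next
      case (cone J)
      then show ?thesis using t \<open>m \<noteq> k\<close>
        by (intro exI[of _ "Cut m"] exI[of _ "Cut t"]) (auto simp: S saturate_def)
    next
      case large
      then show ?thesis using \<open>m \<noteq> k\<close>
        by (intro exI[of _ "Corner m"] exI[of _ "Cut m"]) (auto simp: S saturate_def)
    qed
  qed
  then show False using small by blast
qed

theorem theorem4p4:
  assumes "CARD('d::finite) \<ge> 3"
  shows "\<exists>(P :: (real ^ 'd) set) (Q :: (real ^ 'd) set).
           full_polytope P \<and> full_polytope Q \<and>
           poset_isomorphic (skeleton 0 (CARD('d) - 3) P) (skeleton 0 (CARD('d) - 3) Q) \<and>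
           poset_isomorphic (skeleton 2 (CARD('d) - 1) P) (skeleton 2 (CARD('d) - 1) Q) \<and>
           \<not> poset_isomorphic (faces P) (faces Q)"
proof -
  obtain m k :: 'd where "m \<noteq> k"
    using third_index[OF assms] by metis
  have "\<not> poset_isomorphic (faces (cut_stacked_simplex k k)) (faces (cut_stacked_simplex m k))"
    using pyramidal_isomorphic pyramidal_faces_iff[OF assms]
      pyramidal_cut_stacked_simplex[OF assms] not_pyramidal_cut_stacked_simplex[OF assms \<open>m \<noteq> k\<close>]
    by blast
  then show ?thesis
    using full_polytope_cut_stacked_simplex[OF assms] low_skeleton_isomorphic[OF assms]
      upper_skeleton_isomorphic[OF assms]
    by blast
qed

end
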